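(* Let $G=(V,E)$ be a graph and $v_0\in V$. The edge coloring produced by the BFS-based procedure described below (started at $v_0$) is a valid edge $2$-coloring of the edges it colors, i.e., every vertex of $G$ is incident to edges of at most $2$ distinct colors. The procedure: Let $Q_1\leftarrow\{v_0\}$, $Q_2\leftarrow\emptyset$, mark $v_0$ visited, and set the integer $c\leftarrow 1$. Repeat: (2) color every uncolored edge $(v_i,v_j)$ incident to some $v_i\in Q_1$ with color $c$; (3) while doing so, add every unvisited such neighbor $v_j$ to $Q_2$ and (4) mark these $v_j$ visited; (5) consider the subgraph formed by all edges currently colored $c$, and recolor each connected component of this subgraph with a new color, obtained each time by incrementing $c$; (6) set $c\leftarrow c+1$, $Q_1\leftarrow Q_2$, $Q_2\leftarrow\emptyset$; (7) if $Q_1=\emptyset$ stop, otherwise go back to step (2).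
   Context: An edge coloring of a graph $G=(V,E)$ is a map $\sigma$ from (a subset of) $E$ to the positive integers. For a vertex $v$, its color class is $cc(v)=\{\sigma((v,v')) : (v,v')\in E \text{ colored}\}$. An edge $q$-coloring is an edge coloring in which $|cc(v)|\le q$ for every vertex $v$; in particular an edge $2$-coloring is one where every vertex is incident to edges of at most two distinct colors. *)

theory Defs
  imports Main
begin

text \<open>An edge joining \<open>u\<close> and \<open>v\<close> is the two-element set \<open>{u, v}\<close>.\<close>

definition simple_graph :: "'a set \<Rightarrow> 'a set set \<Rightarrow> bool" where
  "simple_graph V E \<longleftrightarrow>
     finite V \<and> (\<forall>e\<in>E. \<exists>u v. u \<in> V \<and> v \<in> V \<and> u \<noteq> v \<and> e = {u, v})"

text \<open>The value \<open>None\<close> means uncolored.\<close>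

type_synonym 'a coloring = "'a set \<Rightarrow> nat option"

definition edge_coloring :: "'a set set \<Rightarrow> 'a coloring \<Rightarrow> bool" where
  "edge_coloring E \<sigma> \<longleftrightarrow> dom \<sigma> \<subseteq> E \<and> (\<forall>k\<in>ran \<sigma>. 0 < k)"

definition color_class :: "'a set set \<Rightarrow> 'a coloring \<Rightarrow> 'a \<Rightarrow> nat set" where
  "color_class E \<sigma> v = {k. \<exists>w. {v, w} \<in> E \<and> \<sigma> {v, w} = Some k}"

text \<open>Finiteness is stated explicitly because \<open>card\<close> of an infinite set is \<open>0\<close>.\<close>

definition edge_q_coloring :: "nat \<Rightarrow> 'a set \<Rightarrow> 'a set set \<Rightarrow> 'a coloring \<Rightarrow> bool" where
  "edge_q_coloring q V E \<sigma> \<longleftrightarrow>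
     edge_coloring E \<sigma> \<and>
     (\<forall>v\<in>V. finite (color_class E \<sigma> v) \<and> card (color_class E \<sigma> v) \<le> q)"

definition adjacency :: "'a set set \<Rightarrow> ('a \<times> 'a) set" where
  "adjacency F = {(u, v). {u, v} \<in> F}"

text \<open>
  The subgraph formed by \<open>F\<close> has vertex set \<open>\<Union>F\<close>. The quotient below consists of the vertex
  sets of its connected components; each component is represented by its set of edges.
\<close>

definition edge_components :: "'a set set \<Rightarrow> 'a set set set" where
  "edge_components F = (\<lambda>K. {e \<in> F. e \<subseteq> K}) ` (\<Union>F // (adjacency F)\<^sup>*)"

text \<open>
  The state between two rounds. \<open>Q\<^sub>2\<close> is empty at these points, so it only occurs inside a round.
\<close>

record 'a state =
  Q1 :: "'a set"
  visited :: "'a set"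
  counter :: nat
  colors :: "'a coloring"

definition initial :: "'a \<Rightarrow> 'a state" where
  "initial v0 = \<lparr>Q1 = {v0}, visited = {v0}, counter = 1, colors = (\<lambda>_. None)\<rparr>"

definition frontier_edges :: "'a set set \<Rightarrow> 'a state \<Rightarrow> 'a set set" where
  "frontier_edges E s = {e \<in> E. colors s e = None \<and> e \<inter> Q1 s \<noteq> {}}"

definition next_queue :: "'a set set \<Rightarrow> 'a state \<Rightarrow> 'a set" where
  "next_queue E s =
     {w. w \<notin> visited s \<and> (\<exists>v\<in>Q1 s. {v, w} \<in> frontier_edges E s)}"

definition paint :: "'a set set \<Rightarrow> nat \<Rightarrow> 'a coloring \<Rightarrow> 'a coloring" where
  "paint F k \<sigma> = (\<lambda>e. if e \<in> F then Some k else \<sigma> e)"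

fun recolor :: "'a set set list \<Rightarrow> nat \<times> 'a coloring \<Rightarrow> nat \<times> 'a coloring" where
  "recolor [] (c, \<sigma>) = (c, \<sigma>)"
| "recolor (C # Cs) (c, \<sigma>) = recolor Cs (c + 1, paint C (c + 1) \<sigma>)"

text \<open>
  The components are those of the subgraph of \<^emph>\<open>all\<close> edges whose color is the value of the counter
  at the start of the round. The order in which they are recolored is left unspecified, so a round
  is a relation between states.
\<close>

definition bfs_round :: "'a set set \<Rightarrow> 'a state \<Rightarrow> 'a state \<Rightarrow> bool" where
  "bfs_round E s t \<longleftrightarrow>
     (\<exists>\<sigma> Cs c' \<sigma>'.
        \<sigma> = paint (frontier_edges E s) (counter s) (colors s) \<and>
        distinct Cs \<and>
        set Cs = edge_components {e \<in> E. \<sigma> e = Some (counter s)} \<and>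
        recolor Cs (counter s, \<sigma>) = (c', \<sigma>') \<and>
        t = \<lparr>Q1 = next_queue E s, visited = visited s \<union> next_queue E s,
             counter = c' + 1, colors = \<sigma>'\<rparr>)"

inductive bfs_run :: "'a set set \<Rightarrow> 'a state \<Rightarrow> 'a state \<Rightarrow> bool" for E where
  stop: "bfs_round E s t \<Longrightarrow> Q1 t = {} \<Longrightarrow> bfs_run E s t"
| continue: "bfs_round E s s' \<Longrightarrow> Q1 s' \<noteq> {} \<Longrightarrow> bfs_run E s' t \<Longrightarrow> bfs_run E s t"

definition bfs_coloring :: "'a set set \<Rightarrow> 'a \<Rightarrow> 'a coloring \<Rightarrow> bool" where
  "bfs_coloring E v0 \<sigma> \<longleftrightarrow> (\<exists>t. bfs_run E (initial v0) t \<and> \<sigma> = colors t)"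

lemma simple_graph_finite_edges:
  assumes "simple_graph V E"
  shows "finite E"
proof -
  have "E \<subseteq> Pow V" using assms by (auto simp: simple_graph_def)
  then show ?thesis
    using assms by (meson finite_Pow_iff finite_subset simple_graph_def)
qed

lemma finite_edge_components:
  assumes "finite F"
  shows "finite (edge_components F)"
proof -
  have "edge_components F \<subseteq> Pow F" by (auto simp: edge_components_def)
  then show ?thesis using assms by (meson finite_Pow_iff finite_subset)
qed

lemma bfs_round_exists:
  assumes "finite E"
  shows "\<exists>t. bfs_round E s t"
proof -
  define \<sigma> where "\<sigma> = paint (frontier_edges E s) (counter s) (colors s)"
  have "finite (edge_components {e \<in> E. \<sigma> e = Some (counter s)})"
    using assms by (intro finite_edge_components) simp
  then obtain Cs where "distinct Cs" "set Cs = edge_components {e \<in> E. \<sigma> e = Some (counter s)}"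
    using finite_distinct_list by metis
  moreover obtain c' \<sigma>' where "recolor Cs (counter s, \<sigma>) = (c', \<sigma>')" by fastforce
  ultimately show ?thesis unfolding bfs_round_def \<sigma>_def by blast
qed

lemma bfs_run_exists:
  assumes G: "simple_graph V E"
  shows "\<exists>t. bfs_run E s t"
proof (induction "card (V - visited s)" arbitrary: s rule: less_induct)
  case less
  obtain s' where r: "bfs_round E s s'"
    using bfs_round_exists simple_graph_finite_edges[OF G] by blast
  show ?case
  proof (cases "Q1 s' = {}")
    case True
    then show ?thesis using r bfs_run.stop by blast
  next
    case False
    have q: "Q1 s' = next_queue E s" "visited s' = visited s \<union> next_queue E s"
      using r by (auto simp: bfs_round_def)
    obtain w where w: "w \<in> next_queue E s" using False q by auto
    then obtain v where "w \<notin> visited s" "{v, w} \<in> E"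
      by (auto simp: next_queue_def frontier_edges_def)
    moreover from this(2) have "w \<in> V"
      using G unfolding simple_graph_def by (metis doubleton_eq_iff)
    ultimately have "w \<in> V" "w \<notin> visited s" by auto
    then have "V - visited s' \<subset> V - visited s" using q w by auto
    then have "card (V - visited s') < card (V - visited s)"
      using G by (intro psubset_card_mono) (auto simp: simple_graph_def)
    then show ?thesis using less r False bfs_run.continue by blast
  qed
qed

lemma bfs_coloring_exists:
  assumes "simple_graph V E"
  shows "\<exists>\<sigma>. bfs_coloring E v0 \<sigma>"
  using bfs_run_exists[OF assms] by (auto simp: bfs_coloring_def)

end

theory Submission
  imports Defs
begin

text \<open>
  Within one round the edges at a fixed vertex all lie in one component of the newly painted
  subgraph, so a vertex gains at most one color per round. It can gain colors only in the round
  that discovers it and in the round that has it in the queue: afterwards all its edges are colored.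
\<close>

lemma equiv_reachability: "equiv UNIV ((adjacency F)\<^sup>*)"
proof (rule equivI)
  have "sym (adjacency F)" by (auto simp: sym_def adjacency_def insert_commute)
  then show "sym ((adjacency F)\<^sup>*)" by (rule sym_rtrancl)
qed (auto simp: refl_rtrancl trans_rtrancl)

text \<open>Two different components come from two different equivalence classes, which share no
  vertex. An edge lying in both would be a subset of the empty set, and this is why
  \<open>{}\<close> must be kept out of \<open>F\<close>.\<close>

lemma edge_components_disjoint:
  assumes "{} \<notin> F" "C \<in> edge_components F" "D \<in> edge_components F" "C \<noteq> D"
  shows "C \<inter> D = {}"
proof -
  let ?r = "(adjacency F)\<^sup>*"
  \<comment> \<open>The classes are taken over \<open>UNIV\<close> because the reflexive closure is
    an equivalence on the whole type.\<close>
  obtain K L where KL: "K \<in> UNIV // ?r" "L \<in> UNIV // ?r"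
    and CD: "C = {e \<in> F. e \<subseteq> K}" "D = {e \<in> F. e \<subseteq> L}"
    using assms(2,3) unfolding edge_components_def quotient_def by blast
  with assms(4) have "K \<inter> L = {}"
    using quotient_disj[OF equiv_reachability KL] by blast
  then have "e \<in> C \<Longrightarrow> e \<in> D \<Longrightarrow> e = {}" for e unfolding CD by blast
  with CD assms(1) show ?thesis by blast
qed

text \<open>The other end of an edge at \<open>v\<close> is reachable from \<open>v\<close> in one
  step, so the class of \<open>v\<close> contains all of its edges. This is what limits the gain of
  a vertex to one color per round.\<close>

lemma edge_component_at_vertex:
  assumes edges: "\<And>e. e \<in> F \<Longrightarrow> \<exists>u w. e = {u, w}" and v: "v \<in> \<Union>F"
  obtains C where "C \<in> edge_components F" "\<And>e. e \<in> F \<Longrightarrow> v \<in> e \<Longrightarrow> e \<in> C"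
proof
  let ?K = "(adjacency F)\<^sup>* `` {v}"
  show "{e \<in> F. e \<subseteq> ?K} \<in> edge_components F"
    unfolding edge_components_def using v by (intro imageI quotientI)
  fix e assume e: "e \<in> F" "v \<in> e"
  then obtain w where w: "e = {v, w}" using edges by blast
  then have "(v, w) \<in> adjacency F" using e by (simp add: adjacency_def)
  with w e show "e \<in> {e \<in> F. e \<subseteq> ?K}" by auto
qed

text \<open>Guarantees that recoloring the components overwrites every painted edge, so none keeps
  the provisional color.\<close>

lemma Union_edge_components:
  assumes "\<And>e. e \<in> F \<Longrightarrow> \<exists>u w. e = {u, w}"
  shows "\<Union>(edge_components F) = F"
proof
  show "\<Union>(edge_components F) \<subseteq> F" by (auto simp: edge_components_def)
  show "F \<subseteq> \<Union>(edge_components F)"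
  proof
    fix e assume e: "e \<in> F"
    then obtain v where v: "v \<in> e" using assms by blast
    with e have "v \<in> \<Union>F" by blast
    with assms obtain C where "C \<in> edge_components F" "\<And>e. e \<in> F \<Longrightarrow> v \<in> e \<Longrightarrow> e \<in> C"
      using edge_component_at_vertex by metis
    with e v show "e \<in> \<Union>(edge_components F)" by blast
  qed
qed

lemma recolor_outside:
  "recolor Cs (c, \<sigma>) = (c', \<sigma>') \<Longrightarrow> e \<notin> \<Union>(set Cs) \<Longrightarrow> \<sigma>' e = \<sigma> e"
  by (induction Cs arbitrary: c \<sigma>) (auto simp: paint_def)

lemma recolor_counter_mono: "recolor Cs (c, \<sigma>) = (c', \<sigma>') \<Longrightarrow> c \<le> c'"
  by (induction Cs arbitrary: c \<sigma>) fastforce+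

text \<open>The color \<open>k\<close> is the counter value reached when \<open>C\<close> has its
  turn. The components painted later are disjoint from \<open>C\<close> and cannot overwrite it. The
  bounds on \<open>k\<close> separate new colors from old ones and keep them below the next
  counter.\<close>

lemma recolor_component:
  assumes "recolor Cs (c, \<sigma>) = (c', \<sigma>')" "distinct Cs" "C \<in> set Cs"
    and "\<And>C D. C \<in> set Cs \<Longrightarrow> D \<in> set Cs \<Longrightarrow> C \<noteq> D \<Longrightarrow> C \<inter> D = {}"
  shows "\<exists>k. c < k \<and> k \<le> c' \<and> (\<forall>e\<in>C. \<sigma>' e = Some k)"
  using assms
proof (induction Cs arbitrary: c \<sigma>)
  case (Cons D Cs)
  have rec: "recolor Cs (c + 1, paint D (c + 1) \<sigma>) = (c', \<sigma>')"
    using Cons.prems(1) by simp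
  show ?case
  proof (cases "C = D")
    case True
    have "\<sigma>' e = Some (c + 1)" if "e \<in> C" for e
    proof -
      have "e \<notin> \<Union>(set Cs)"
        using Cons.prems(2) Cons.prems(4)[of D] that True by fastforce
      then show ?thesis using recolor_outside[OF rec] that True by (simp add: paint_def)
    qed
    then show ?thesis using recolor_counter_mono[OF rec] by (intro exI[of _ "c + 1"]) auto
  next
    case False
    then have "\<exists>k. c + 1 < k \<and> k \<le> c' \<and> (\<forall>e\<in>C. \<sigma>' e = Some k)"
      using Cons.prems by (intro Cons.IH[OF rec]) auto
    then show ?thesis by (meson add_lessD1)
  qed
qed simp

definition bfs_invariant :: "'a set set \<Rightarrow> 'a state \<Rightarrow> bool" where
  "bfs_invariant E s \<longleftrightarrow>
     dom (colors s) \<subseteq> E \<and>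
     (\<forall>k\<in>ran (colors s). 0 < k \<and> k < counter s) \<and>
     Q1 s \<subseteq> visited s \<and>
     (\<forall>e\<in>E. e \<inter> (visited s - Q1 s) \<noteq> {} \<longrightarrow> colors s e \<noteq> None) \<and>
     (\<forall>v. v \<notin> visited s \<longrightarrow> color_class E (colors s) v = {}) \<and>
     (\<forall>v\<in>Q1 s. \<exists>k. color_class E (colors s) v \<subseteq> {k}) \<and>
     (\<forall>v. \<exists>k l. color_class E (colors s) v \<subseteq> {k, l})"

lemma bfs_invariant_initial: "bfs_invariant E (initial v0)"
  by (simp add: bfs_invariant_def initial_def color_class_def)

text \<open>Painted edges end only in the old queue or in the new one. An old queue vertex adds one
  color to at most one, a new one adds one color to none, and all other vertices are
  unaffected.\<close>

lemma bfs_invariant_round: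
  assumes edges: "\<And>e. e \<in> E \<Longrightarrow> \<exists>u w. e = {u, w}"
    and inv: "bfs_invariant E s" and round: "bfs_round E s t"
  shows "bfs_invariant E t"
proof -
  let ?F = "frontier_edges E s" and ?N = "next_queue E s"
  define \<tau> where "\<tau> = paint ?F (counter s) (colors s)"
  obtain Cs c' \<sigma>' where dist: "distinct Cs"
    and Cs: "set Cs = edge_components {e \<in> E. \<tau> e = Some (counter s)}"
    and rec: "recolor Cs (counter s, \<tau>) = (c', \<sigma>')"
    and t: "t = \<lparr>Q1 = ?N, visited = visited s \<union> ?N, counter = c' + 1, colors = \<sigma>'\<rparr>"
    using round unfolding bfs_round_def \<tau>_def by blast
  have dom: "dom (colors s) \<subseteq> E"
    and ran: "\<forall>k\<in>ran (colors s). 0 < k \<and> k < counter s"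
    and queue: "Q1 s \<subseteq> visited s"
    and processed: "\<forall>e\<in>E. e \<inter> (visited s - Q1 s) \<noteq> {} \<longrightarrow> colors s e \<noteq> None"
    and new: "\<forall>v. v \<notin> visited s \<longrightarrow> color_class E (colors s) v = {}"
    and one: "\<forall>v\<in>Q1 s. \<exists>k. color_class E (colors s) v \<subseteq> {k}"
    and two: "\<forall>v. \<exists>k l. color_class E (colors s) v \<subseteq> {k, l}"
    using inv unfolding bfs_invariant_def by - (elim conjE, assumption)+
  have FE: "?F \<subseteq> E" by (auto simp: frontier_edges_def)
  have Fpair: "\<And>e. e \<in> ?F \<Longrightarrow> \<exists>u w. e = {u, w}" using edges FE by blast
  \<comment> \<open>Since older colors are below the counter, the edges of the provisional color are
    exactly those painted in this round.\<close>
  have "{e \<in> E. \<tau> e = Some (counter s)} = ?F"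
    using FE ran by (auto simp: \<tau>_def paint_def ran_def split: if_splits)
  with Cs have Cs: "set Cs = edge_components ?F" by simp
  have "{} \<notin> ?F" using Fpair by blast
  then have disj: "C \<inter> D = {}" if "C \<in> set Cs" "D \<in> set Cs" "C \<noteq> D" for C D
    using edge_components_disjoint that unfolding Cs by blast
  have cover: "\<Union>(set Cs) = ?F"
    unfolding Cs using Fpair by (rule Union_edge_components)
  have old: "\<sigma>' e = colors s e" if "e \<notin> ?F" for e
    using recolor_outside[OF rec] that cover by (simp add: \<tau>_def paint_def)
  have comp: "\<exists>k. counter s < k \<and> k \<le> c' \<and> (\<forall>e\<in>C. \<sigma>' e = Some k)" if "C \<in> set Cs" for C
    using recolor_component[OF rec dist that disj] .
  have fresh: "\<exists>k. counter s < k \<and> k \<le> c' \<and> \<sigma>' e = Some k" if "e \<in> ?F" for e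
    using comp that cover by blast
  have le: "counter s \<le> c'" using rec by (rule recolor_counter_mono)
  \<comment> \<open>A visited end outside the queue would have only colored edges, whereas frontier
    edges are uncolored. An unvisited end is joined to a queue vertex and is therefore discovered
    now.\<close>
  have F_ends: "\<Union>?F \<subseteq> Q1 s \<union> ?N"
  proof
    fix v assume "v \<in> \<Union>?F"
    then obtain e where e: "e \<in> ?F" "v \<in> e" by blast
    then obtain u where u: "u \<in> e" "u \<in> Q1 s" by (auto simp: frontier_edges_def)
    show "v \<in> Q1 s \<union> ?N"
    proof (cases "v \<in> visited s")
      case True
      then show ?thesis using processed e by (auto simp: frontier_edges_def)
    next
      case False
      with queue u have "u \<noteq> v" by blast
      with e u have "e = {u, v}" using Fpair by blast
      with e u False show ?thesis by (auto simp: next_queue_def)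
    qed
  qed
  \<comment> \<open>The witness is the color of the one component containing all painted edges at
    \<open>v\<close>; the remaining edges at \<open>v\<close> keep their status.\<close>
  have gain: "\<exists>k. color_class E \<sigma>' v \<subseteq> insert k (color_class E (colors s) v)"
    if v: "v \<in> \<Union>?F" for v
  proof -
    obtain C where C: "C \<in> edge_components ?F" "\<And>e. e \<in> ?F \<Longrightarrow> v \<in> e \<Longrightarrow> e \<in> C"
      using edge_component_at_vertex[OF Fpair v] by blast
    from comp[of C] C(1) obtain k where k: "\<forall>e\<in>C. \<sigma>' e = Some k" by (auto simp: Cs)
    have "color_class E \<sigma>' v \<subseteq> insert k (color_class E (colors s) v)"
    proof
      fix j assume "j \<in> color_class E \<sigma>' v"
      then obtain w where w: "{v, w} \<in> E" "\<sigma>' {v, w} = Some j" by (auto simp: color_class_def)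
      show "j \<in> insert k (color_class E (colors s) v)"
      proof (cases "{v, w} \<in> ?F")
        case True
        then show ?thesis using C(2) k w(2) by fastforce
      next
        case False
        then show ?thesis using old w by (auto simp: color_class_def)
      qed
    qed
    then show ?thesis ..
  qed
  have same: "color_class E \<sigma>' v = color_class E (colors s) v" if "v \<notin> \<Union>?F" for v
  proof -
    have "{v, w} \<notin> ?F" for w using that by blast
    then show ?thesis using old by (simp add: color_class_def)
  qed
  have N_new: "v \<notin> visited s" if "v \<in> ?N" for v
    using that by (simp add: next_queue_def)
  have N_one: "\<exists>k. color_class E \<sigma>' v \<subseteq> {k}" if "v \<in> ?N" for v
  proof -
    have "color_class E (colors s) v = {}" using new N_new[OF that] by blast
    then show ?thesis using gain[of v] same[of v] by (cases "v \<in> \<Union>?F") (simp_all only:, blast)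
  qed
  show ?thesis
    unfolding bfs_invariant_def t state.simps
  proof (intro conjI ballI allI impI)
    show "dom \<sigma>' \<subseteq> E"
      using dom old FE by (metis domIff subset_iff)
    \<comment> \<open>Colors given in this round lie above \<open>counter s\<close> and go up to
      \<open>c'\<close>; the final increment makes the bound strict.\<close>
    show "0 < k" "k < c' + 1" if k: "k \<in> ran \<sigma>'" for k
    proof -
      obtain e where e: "\<sigma>' e = Some k" using k by (auto simp: ran_def)
      have "0 < k \<and> k < c' + 1"
      proof (cases "e \<in> ?F")
        case True
        then show ?thesis using fresh[of e] e by auto
      next
        case False
        then show ?thesis using ranI[of "colors s" e k] ran old e le by fastforce
      qed
      then show "0 < k" "k < c' + 1" by auto
    qed
    show "?N \<subseteq> visited s \<union> ?N" by blast
    \<comment> \<open>The vertices concerned were processed earlier or are leaving the queue. In the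
      second case any edge still uncolored before the round belongs to \<open>?F\<close>.\<close>
    show "\<sigma>' e \<noteq> None" if e: "e \<in> E" "e \<inter> (visited s \<union> ?N - ?N) \<noteq> {}" for e
    proof (cases "e \<in> ?F")
      case True
      then show ?thesis using fresh by blast
    next
      case False
      with e processed have "colors s e \<noteq> None" by (auto simp: frontier_edges_def)
      with False old show ?thesis by simp
    qed
    show "color_class E \<sigma>' v = {}" if "v \<notin> visited s \<union> ?N" for v
    proof -
      have "v \<notin> \<Union>?F" using that F_ends queue by blast
      with same new that show ?thesis by simp
    qed
    show "\<exists>k. color_class E \<sigma>' v \<subseteq> {k}" if "v \<in> ?N" for v
      using N_one that .
    show "\<exists>k l. color_class E \<sigma>' v \<subseteq> {k, l}" for v
    proof -
      consider "v \<notin> \<Union>?F" | "v \<in> ?N" | "v \<in> \<Union>?F" "v \<in> Q1 s" using F_ends by blast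
      then show ?thesis
      proof cases
        case 1
        then show ?thesis using two same by simp
      next
        case 2
        then show ?thesis using N_one by fast
      next
        \<comment> \<open>Here \<open>l\<close> bounds what the vertex had while waiting in the
          queue, and \<open>k\<close> is the gain of this round.\<close>
        case 3
        then obtain k l where "color_class E \<sigma>' v \<subseteq> insert k (color_class E (colors s) v)"
          "color_class E (colors s) v \<subseteq> {l}"
          using gain one by meson
        then have "color_class E \<sigma>' v \<subseteq> {k, l}" by blast
        then show ?thesis by blast
      qed
    qed
  qed
qed

lemma bfs_invariant_run:
  assumes "bfs_run E s t" "\<And>e. e \<in> E \<Longrightarrow> \<exists>u w. e = {u, w}" "bfs_invariant E s"
  shows "bfs_invariant E t"
  using assms
proof (induction rule: bfs_run.induct)
  case (stop s t)
  then show ?case using bfs_invariant_round[OF _ _ stop.hyps(1)] by simp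
next
  case (continue s s' t)
  then show ?case using bfs_invariant_round[OF _ _ continue.hyps(1)] by simp
qed

theorem theorem1:
  fixes V :: "'a set" and E :: "'a set set" and v0 :: 'a and \<sigma> :: "'a coloring"
  assumes "simple_graph V E"
    and "v0 \<in> V"
    and "bfs_coloring E v0 \<sigma>"
  shows "edge_q_coloring 2 V E \<sigma>"
proof -
  obtain t where run: "bfs_run E (initial v0) t" and \<sigma>: "\<sigma> = colors t"
    using assms(3) by (auto simp: bfs_coloring_def)
  have "\<And>e. e \<in> E \<Longrightarrow> \<exists>u w. e = {u, w}"
    using assms(1) unfolding simple_graph_def by blast
  then have inv: "bfs_invariant E t"
    using bfs_invariant_run[OF run _ bfs_invariant_initial] by blast
  have "finite (color_class E \<sigma> v) \<and> card (color_class E \<sigma> v) \<le> 2" for v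
  proof -
    obtain k l where kl: "color_class E \<sigma> v \<subseteq> {k, l}"
      using inv \<sigma> unfolding bfs_invariant_def by meson
    then have "card (color_class E \<sigma> v) \<le> card {k, l}" by (intro card_mono) auto
    also have "\<dots> \<le> 2" by (simp add: card_insert_if)
    finally show ?thesis using kl finite_subset by blast
  qed
  with inv show ?thesis
    by (simp add: edge_q_coloring_def edge_coloring_def bfs_invariant_def \<sigma>)
qed

end
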